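(* Let $\beta>0$, $\gamma>1$ with $\beta\gamma<n$, and let $p,q>0$. (1) The equation $$u(x)=c(x)W_{\beta,\gamma}(u^p)(x),\quad x\in\mathbb{R}^n,$$ has positive solutions for some double bounded $c(x)$ if and only if $$p>\frac{n(\gamma-1)}{n-\beta\gamma}.$$ (2) The system $$u(x)=c_1(x)W_{\beta,\gamma}(v^q)(x),\qquad v(x)=c_2(x)W_{\beta,\gamma}(u^p)(x),\quad x\in\mathbb{R}^n,$$ has positive solutions $u,v$ for some double bounded $c_1(x)$ and $c_2(x)$ if and only if $pq>(\gamma-1)^2$ and $$\max\Big\{\frac{\beta\gamma(p+\gamma-1)}{pq-(\gamma-1)^2},\ \frac{\beta\gamma(q+\gamma-1)}{pq-(\gamma-1)^2}\Big\}<\frac{n-\beta\gamma}{\gamma-1}.$$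
   Context: For a positive locally integrable function $f$ on $\mathbb{R}^n$, the Wolff potential is $$W_{\beta,\gamma}(f)(x):=\int_0^\infty\Big[\frac{\int_{B_t(x)}f(y)\,dy}{t^{n-\beta\gamma}}\Big]^{\frac1{\gamma-1}}\frac{dt}{t},$$ where $B_t(x)$ is the ball of radius $t$ centred at $x$. A function $c:\mathbb{R}^n\to\mathbb{R}$ is called double bounded if there is a constant $C>0$ such that $\frac1C\le c(x)\le C$ for all $x\in\mathbb{R}^n$. Solutions are positive, finite-valued functions on $\mathbb{R}^n$. *)

theory Defs
  imports "HOL-Analysis.Analysis"
begin

definition locally_integrable :: "(real ^ 'n \<Rightarrow> real) \<Rightarrow> bool" where
  "locally_integrable f \<longleftrightarrow> (\<forall>K. compact K \<longrightarrow> set_integrable lebesgue K f)"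

text \<open>The integral over balls is the real-valued Bochner integral, so the definition is meaningful
  only for locally integrable \<open>f\<close>; the outer integral takes values in \<open>[0, \<infinity>]\<close>, so divergence
  of the potential gives the value \<open>\<infinity>\<close>.\<close>

definition wolff_potential :: "real \<Rightarrow> real \<Rightarrow> (real ^ 'n \<Rightarrow> real) \<Rightarrow> real ^ 'n \<Rightarrow> ennreal" where
  "wolff_potential \<beta> \<gamma> f x =
     (\<integral>\<^sup>+ t\<in>{0<..}.
        ennreal (((LINT y:ball x t|lebesgue. f y) / t powr (real CARD('n) - \<beta> * \<gamma>))
                   powr (1 / (\<gamma> - 1)) / t) \<partial>lborel)"

definition double_bounded :: "(real ^ 'n \<Rightarrow> real) \<Rightarrow> bool" where
  "double_bounded c \<longleftrightarrow> (\<exists>C>0. \<forall>x. 1 / C \<le> c x \<and> c x \<le> C)"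

text \<open>In the two predicates below the equations are equations in \<open>[0, \<infinity>]\<close>; as \<open>u\<close> and \<open>v\<close> are
  real-valued and the coefficients are positive, they force the potentials to be finite everywhere.
  Local integrability of the densities, which the potential presupposes, includes
  Lebesgue measurability.\<close>

definition positive_solution_equation ::
  "real \<Rightarrow> real \<Rightarrow> real \<Rightarrow> (real ^ 'n \<Rightarrow> real) \<Rightarrow> (real ^ 'n \<Rightarrow> real) \<Rightarrow> bool" where
  "positive_solution_equation \<beta> \<gamma> p c u \<longleftrightarrow>
     (\<forall>x. 0 < u x) \<and>
     locally_integrable (\<lambda>y. u y powr p) \<and>
     (\<forall>x. ennreal (u x) = ennreal (c x) * wolff_potential \<beta> \<gamma> (\<lambda>y. u y powr p) x)"

definition positive_solution_system ::
  "real \<Rightarrow> real \<Rightarrow> real \<Rightarrow> real \<Rightarrow> (real ^ 'n \<Rightarrow> real) \<Rightarrow> (real ^ 'n \<Rightarrow> real) \<Rightarrow>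
   (real ^ 'n \<Rightarrow> real) \<Rightarrow> (real ^ 'n \<Rightarrow> real) \<Rightarrow> bool" where
  "positive_solution_system \<beta> \<gamma> p q c1 c2 u v \<longleftrightarrow>
     (\<forall>x. 0 < u x) \<and> (\<forall>x. 0 < v x) \<and>
     locally_integrable (\<lambda>y. u y powr p) \<and>
     locally_integrable (\<lambda>y. v y powr q) \<and>
     (\<forall>x. ennreal (u x) = ennreal (c1 x) * wolff_potential \<beta> \<gamma> (\<lambda>y. v y powr q) x) \<and>
     (\<forall>x. ennreal (v x) = ennreal (c2 x) * wolff_potential \<beta> \<gamma> (\<lambda>y. u y powr p) x)"

end

theory Submission
  imports Defs
begin

text \<open>Write \<open>d = n - \<beta>\<gamma>\<close> and \<open>g = \<gamma> - 1\<close>. A solution \<open>u\<close> of the single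
  equation gives the solution \<open>(u, u)\<close> of the system with \<open>p = q\<close>, for which the two exponent conditions
  agree; so the system is the heart of the matter.

  Sufficiency: for \<open>\<beta>\<gamma> < \<theta> < n\<close> the potential of \<open>(1 + |x|) powr -\<theta>\<close> is comparable, from above and below,
  to \<open>(1 + |x|) powr -((\<theta> - \<beta>\<gamma>)/g)\<close>. Since the coefficients may be any double bounded functions, the pair
  \<open>u = (1 + |x|) powr -A\<close>, \<open>v = (1 + |x|) powr -B\<close> is a solution as soon as \<open>g A = q B - \<beta>\<gamma>\<close> and
  \<open>g B = p A - \<beta>\<gamma>\<close>, with \<open>q B\<close> and \<open>p A\<close> in the admissible range. Solving for \<open>A\<close> and \<open>B\<close> gives exactly the two
  quotients in the theorem, and the upper end \<open>n\<close> of the range corresponds to \<open>A, B < d/g\<close>.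

  Necessity: let \<open>M(r)\<close> be the integral of \<open>v\<^sup>q\<close> over the ball of radius \<open>r\<close> around the origin. Radii
  comparable to \<open>r\<close> in the potential give \<open>u \<ge> c (M(r)/r\<^sup>d) powr (1/g)\<close> on the ball of radius \<open>2r\<close>
  (lemma \<open>ball_mass_powr_ge\<close> integrates this). Doing this for \<open>u\<close> and then for \<open>v\<close> bounds the integral of \<open>v\<^sup>q\<close>
  over balls of radius \<open>r/2\<close>, centred or in the shell from \<open>r\<close> to \<open>2r\<close>, below by
  \<open>K r powr (n + \<beta>\<gamma> q/g) (M(r)/r\<^sup>d) powr \<sigma>\<close> with \<open>\<sigma> = pq/g\<^sup>2\<close>. Lemma
  \<open>no_global_solution_inequality\<close> derives from this that \<open>\<sigma> > 1\<close>, because otherwise \<open>M(r)/r\<^sup>d\<close> would be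
  unbounded and the potential infinite at the origin, and that the total power \<open>n + \<beta>\<gamma> q/g - d\<sigma>\<close> of
  \<open>r\<close> is negative, because otherwise \<open>M\<close> would be bounded and yet grow by a fixed amount at each doubling of
  the radius. Rearranged, these are the stated conditions.\<close>

section \<open>Integrals over balls\<close>

abbreviation ball_mass :: "(real ^ 'n \<Rightarrow> real) \<Rightarrow> real ^ 'n \<Rightarrow> real \<Rightarrow> real" where
  "ball_mass f x t \<equiv> (LINT y:ball x t|lebesgue. f y)"

lemma set_integrable_ball:
  assumes "locally_integrable f"
  shows "set_integrable lebesgue (ball x t) f"
proof -
  have "set_integrable lebesgue (cball x t) f"
    using assms by (simp add: locally_integrable_def)
  then show ?thesis
    by (rule set_integrable_subset) auto
qed

lemma integrable_indicator_ball:
  assumes "locally_integrable f"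
  shows "integrable lebesgue (\<lambda>y. indicator (ball x t) y * f y)"
  using set_integrable_ball[OF assms, of x t] by (simp add: set_integrable_def)

lemma ball_mass_nonneg:
  assumes "\<And>y. 0 \<le> f y"
  shows "0 \<le> ball_mass f x t"
  unfolding set_lebesgue_integral_def
  by (rule integral_nonneg_AE) (auto simp: assms)

text \<open>Superadditivity is what turns mass on a ball away from the origin into growth of the mass of
  centred balls.\<close>

lemma ball_mass_add_le:
  assumes f: "locally_integrable f" "\<And>y. 0 \<le> f y"
    and "ball x r \<subseteq> ball w T" "ball z t \<subseteq> ball w T" "ball x r \<inter> ball z t = {}"
  shows "ball_mass f x r + ball_mass f z t \<le> ball_mass f w T"
proof -
  note int = integrable_indicator_ball[OF f(1)]
  have "ball_mass f x r + ball_mass f z t =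
      (\<integral>y. indicator (ball x r) y * f y + indicator (ball z t) y * f y \<partial>lebesgue)"
    by (simp add: set_lebesgue_integral_def Bochner_Integration.integral_add[OF int int])
  also have "\<dots> \<le> (\<integral>y. indicator (ball w T) y * f y \<partial>lebesgue)"
  proof (rule integral_mono[OF Bochner_Integration.integrable_add[OF int int] int])
    fix y
    show "indicator (ball x r) y * f y + indicator (ball z t) y * f y \<le> indicator (ball w T) y * f y"
      using assms(3-5) f(2)[of y] by (auto simp: indicator_def disjoint_iff subset_iff simp del: mem_ball)
  qed
  finally show ?thesis
    by (simp add: set_lebesgue_integral_def)
qed

lemma ball_mass_mono:
  assumes "locally_integrable f" "\<And>y. 0 \<le> f y" "ball x r \<subseteq> ball z t"
  shows "ball_mass f x r \<le> ball_mass f z t"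
  using ball_mass_add_le[OF assms(1,2), of x r z t z 0] assms(3) by (simp add: set_lebesgue_integral_def)

lemma integral_const_ball:
  fixes x :: "real ^ 'n"
  assumes "0 \<le> t"
  shows "(LINT y:ball x t|lebesgue. K) = K * (unit_ball_vol CARD('n) * t powr real CARD('n))"
proof -
  have "(LINT y:ball x t|lebesgue. K) = measure lebesgue (ball x t) * K"
    by (simp add: set_lebesgue_integral_def)
  also have "measure lebesgue (ball x t) = unit_ball_vol CARD('n) * t ^ CARD('n)"
    using content_ball[OF assms, of x] by simp
  finally show ?thesis
    using assms by (simp add: powr_realpow')
qed

lemma locally_integrable_continuous:
  fixes f :: "real ^ 'n \<Rightarrow> real"
  assumes "continuous_on UNIV f"
  shows "locally_integrable f"
  unfolding locally_integrable_def
proof (intro allI impI)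
  fix K :: "(real ^ 'n) set" assume K: "compact K"
  obtain a b where ab: "K \<subseteq> cbox a b"
    using bounded_subset_cbox_symmetric[OF compact_imp_bounded[OF K]] by blast
  have "set_integrable lebesgue (cbox a b) f"
    by (rule absolutely_integrable_continuous) (rule continuous_on_subset[OF assms], simp)
  then show "set_integrable lebesgue K f"
    by (rule set_integrable_subset) (use ab K in \<open>auto simp: borel_closed compact_imp_closed\<close>)
qed

lemma ball_mass_ge:
  fixes x :: "real ^ 'n"
  assumes "locally_integrable f" "0 \<le> t" "\<And>y. y \<in> ball x t \<Longrightarrow> K \<le> f y"
  shows "K * (unit_ball_vol CARD('n) * t powr real CARD('n)) \<le> ball_mass f x t"
  unfolding integral_const_ball[OF assms(2), of x, symmetric]
  by (rule set_integral_mono)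
    (use assms set_integrable_ball locally_integrable_continuous[of "\<lambda>_. K"] in auto)

lemma ball_mass_le:
  fixes x :: "real ^ 'n"
  assumes "locally_integrable f" "0 \<le> t" "\<And>y. y \<in> ball x t \<Longrightarrow> f y \<le> K"
  shows "ball_mass f x t \<le> K * (unit_ball_vol CARD('n) * t powr real CARD('n))"
  unfolding integral_const_ball[OF assms(2), of x, symmetric]
  by (rule set_integral_mono)
    (use assms set_integrable_ball locally_integrable_continuous[of "\<lambda>_. K"] in auto)

section \<open>Lower bounds for the Wolff potential\<close>

text \<open>Both directions of the proof bound the potential from below by a single dyadic range of radii:
  on \<open>[\<rho>, 2\<rho>]\<close> the measure \<open>dt/t\<close> has mass at least \<open>1/2\<close>, and the integrand is bounded below there by
  its value with the smallest mass and the largest radius.\<close>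

lemma wolff_potential_ge:
  fixes f :: "real ^ 'n \<Rightarrow> real" and \<beta> \<gamma> :: real
  assumes "1 < \<gamma>" "\<beta> * \<gamma> < real CARD('n)" "0 < \<rho>" "0 \<le> m"
    and m: "\<And>t. \<rho> \<le> t \<Longrightarrow> t \<le> 2 * \<rho> \<Longrightarrow> m \<le> ball_mass f x t"
  shows "ennreal ((m / (2 * \<rho>) powr (real CARD('n) - \<beta> * \<gamma>)) powr (1 / (\<gamma> - 1)) / 2)
           \<le> wolff_potential \<beta> \<gamma> f x"
proof -
  let ?d = "real CARD('n) - \<beta> * \<gamma>" and ?s = "1 / (\<gamma> - 1)"
  define c where "c = (m / (2 * \<rho>) powr ?d) powr ?s / (2 * \<rho>)"
  have c: "0 \<le> c" using assms by (simp add: c_def)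
  have "ennreal ((m / (2 * \<rho>) powr ?d) powr ?s / 2) = ennreal c * ennreal \<rho>"
    using assms c by (simp add: ennreal_mult[symmetric] c_def)
  also have "\<dots> = (\<integral>\<^sup>+ t. ennreal c * indicator {\<rho>..2*\<rho>} t \<partial>lborel)"
    using assms by (simp add: nn_integral_cmult_indicator)
  also have "\<dots> \<le> wolff_potential \<beta> \<gamma> f x"
    unfolding wolff_potential_def
  proof (rule nn_integral_mono)
    fix t :: real
    show "ennreal c * indicator {\<rho>..2*\<rho>} t \<le>
        ennreal ((ball_mass f x t / t powr ?d) powr ?s / t) * indicator {0<..} t"
    proof (cases "t \<in> {\<rho>..2*\<rho>}")
      case True
      then have t: "0 < t" "\<rho> \<le> t" "t \<le> 2 * \<rho>" using assms by auto
      have "t powr ?d \<le> (2 * \<rho>) powr ?d"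
        using t assms by (intro powr_mono2) auto
      then have "m / (2 * \<rho>) powr ?d \<le> ball_mass f x t / t powr ?d"
        using t assms m[OF t(2,3)] by (intro frac_le) (auto intro: order_trans)
      then have "(m / (2 * \<rho>) powr ?d) powr ?s \<le> (ball_mass f x t / t powr ?d) powr ?s"
        using assms by (intro powr_mono2) auto
      then have "c \<le> (ball_mass f x t / t powr ?d) powr ?s / t"
        unfolding c_def using t by (intro frac_le) auto
      then show ?thesis using t True by (simp add: ennreal_leI)
    qed simp
  qed
  finally show ?thesis .
qed

text \<open>A ball of radius at least \<open>3r\<close> around a point with \<open>norm x \<le> 2r\<close> contains the centred ball of radius
  \<open>r\<close>, so the previous bound applies on the range \<open>[3r, 6r]\<close>.\<close>

lemma wolff_potential_ge_centred_mass:
  fixes f :: "real ^ 'n \<Rightarrow> real" and \<beta> \<gamma> :: real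
  assumes "1 < \<gamma>" "\<beta> * \<gamma> < real CARD('n)" and f: "locally_integrable f" "\<And>y. 0 \<le> f y"
    and r: "0 < r" "norm x \<le> 2 * r"
  shows "ennreal ((ball_mass f 0 r / (6 * r) powr (real CARD('n) - \<beta> * \<gamma>)) powr (1 / (\<gamma> - 1)) / 2)
           \<le> wolff_potential \<beta> \<gamma> f x"
proof -
  have "ball_mass f 0 r \<le> ball_mass f x t" if "3 * r \<le> t" for t
  proof (rule ball_mass_mono[OF f])
    show "ball (0 :: real ^ 'n) r \<subseteq> ball x t"
    proof
      fix y :: "real ^ 'n" assume "y \<in> ball 0 r"
      then have "norm (x - y) < t"
        using norm_triangle_ineq4[of x y] r that by simp
      then show "y \<in> ball x t" by (simp add: dist_norm)
    qed
  qed
  with wolff_potential_ge[OF assms(1,2), of "3 * r" "ball_mass f 0 r" x f] show ?thesis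
    using r ball_mass_nonneg[of f 0 r] f(2) by simp
qed

text \<open>One passage through an equation: mass of the density \<open>f\<close> on a centred ball bounds \<open>u\<close> from below
  on the ball of twice the radius, and hence the mass of \<open>u\<^sup>p\<close> on every ball of radius \<open>r/2\<close> in it. The
  centre \<open>z\<close> is left free for two uses: \<open>z = 0\<close> allows the estimate to be iterated, and
  \<open>norm z = 3r/2\<close> gives a ball in the shell between the radii \<open>r\<close> and \<open>2r\<close>, where the mass is additional to
  that of the centred ball.\<close>

lemma ball_mass_powr_ge:
  fixes f u :: "real ^ 'n \<Rightarrow> real" and \<beta> \<gamma> :: real
  assumes "1 < \<gamma>" "\<beta> * \<gamma> < real CARD('n)" and f: "locally_integrable f" "\<And>y. 0 \<le> f y"
    and u: "locally_integrable (\<lambda>y. u y powr p)" "\<And>y. 0 < u y" and "0 < p"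
    and C: "0 < C" "\<And>x. ennreal (1 / C) * wolff_potential \<beta> \<gamma> f x \<le> ennreal (u x)"
  shows "\<exists>k>0. \<forall>r>0. \<forall>z. norm z \<le> 3 / 2 * r \<longrightarrow>
     k * r powr real CARD('n) * (ball_mass f 0 r / r powr (real CARD('n) - \<beta> * \<gamma>)) powr (1 / (\<gamma> - 1) * p)
       \<le> ball_mass (\<lambda>y. u y powr p) z (r / 2)"
proof -
  let ?d = "real CARD('n) - \<beta> * \<gamma>" and ?s = "1 / (\<gamma> - 1)"
  define c where "c = 1 / C * (1 / 6 powr ?d) powr ?s / 2"
  define \<omega> where "\<omega> = unit_ball_vol CARD('n)"
  have c: "0 < c" using C by (simp add: c_def)
  have \<omega>: "0 < \<omega>" by (simp add: \<omega>_def)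
  have ge: "c * (ball_mass f 0 r / r powr ?d) powr ?s \<le> u x" if r: "0 < r" "norm x \<le> 2 * r" for r x
  proof -
    have "ennreal (c * (ball_mass f 0 r / r powr ?d) powr ?s) =
        ennreal (1 / C) * ennreal ((ball_mass f 0 r / (6 * r) powr ?d) powr ?s / 2)"
      using C by (simp add: ennreal_mult[symmetric] c_def powr_mult powr_divide)
    also have "\<dots> \<le> ennreal (1 / C) * wolff_potential \<beta> \<gamma> f x"
      by (intro mult_left_mono wolff_potential_ge_centred_mass assms r) auto
    also have "\<dots> \<le> ennreal (u x)" by (rule C)
    finally show ?thesis using u(2)[of x] by (simp add: ennreal_le_iff less_imp_le)
  qed
  define k where "k = c powr p * \<omega> * (1 / 2) powr real CARD('n)"
  have "k * r powr real CARD('n) * (ball_mass f 0 r / r powr ?d) powr (?s * p)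
      \<le> ball_mass (\<lambda>y. u y powr p) z (r / 2)" if r: "0 < r" "norm z \<le> 3 / 2 * r" for r z
  proof -
    let ?K = "(c * (ball_mass f 0 r / r powr ?d) powr ?s) powr p"
    have "?K * (\<omega> * (r / 2) powr real CARD('n)) \<le> ball_mass (\<lambda>y. u y powr p) z (r / 2)"
      unfolding \<omega>_def
    proof (rule ball_mass_ge)
      fix y assume "y \<in> ball z (r / 2)"
      then have "norm y \<le> 2 * r"
        using r norm_triangle_ineq2[of y z] by (simp add: dist_norm norm_minus_commute)
      then show "?K \<le> u y powr p"
        using ge[OF r(1)] \<open>0 < p\<close> c by (intro powr_mono2) auto
    qed (use u r in auto)
    also have "?K = c powr p * (ball_mass f 0 r / r powr ?d) powr (?s * p)"
      by (simp only: powr_mult powr_powr)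
    finally show ?thesis
      by (simp add: k_def powr_mult powr_divide mult_ac)
  qed
  moreover have "0 < k" using c \<omega> by (simp add: k_def)
  ultimately show ?thesis by blast
qed

section \<open>Necessity of the exponent conditions\<close>

lemma powr_unbounded:
  fixes e K B r0 :: real
  assumes "0 < e" "0 < K"
  obtains r where "r0 \<le> r" "0 < r" "B < K * r powr e"
proof -
  define r where "r = max (max r0 1) (((\<bar>B\<bar> + 1) / K) powr (1 / e))"
  have "(\<bar>B\<bar> + 1) / K = (((\<bar>B\<bar> + 1) / K) powr (1 / e)) powr e"
    using assms by (simp add: powr_powr)
  also have "\<dots> \<le> r powr e"
    using assms by (intro powr_mono2) (auto simp: r_def)
  finally have "B < K * r powr e"
    using assms by (simp add: field_simps)
  then show ?thesis
    by (intro that[of r]) (auto simp: r_def)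
qed

text \<open>Write \<open>M(r)\<close> for the mass on the centred ball of radius \<open>r\<close>, \<open>d = n - \<beta>\<gamma>\<close> and \<open>m(r) = M(r)/r\<^sup>d\<close>. The
  hypothesis \<open>self\<close> is the estimate obtained by passing once through both equations of the system.

  With \<open>z = 0\<close> it gives, as soon as \<open>m(r) > 0\<close>, the inequality
  \<open>K r powr (\<beta>\<gamma> + e) \<le> m(r) powr (1 - \<sigma>)\<close>. Finiteness of the potential at the
  origin bounds \<open>m\<close> from above, so for \<open>\<sigma> \<le> 1\<close> the right side stays bounded while the left side does not.

  In terms of \<open>M\<close> the estimate carries the factor \<open>r powr (n + e - d\<sigma>)\<close>. If that exponent
  were nonnegative, then for large \<open>r\<close> the choice \<open>z = 0\<close> would give \<open>K M powr \<sigma> \<le> M\<close>, so that \<open>M\<close>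
  is bounded because \<open>\<sigma> > 1\<close>, whereas balls in dyadic shells would each contribute at least a fixed amount to \<open>M\<close>. This
  argument covers the borderline exponent as well.\<close>

lemma no_global_solution_inequality:
  fixes f :: "real ^ 'n \<Rightarrow> real" and \<beta> \<gamma> \<sigma> e K :: real
  assumes "0 < \<beta>" "1 < \<gamma>" "\<beta> * \<gamma> < real CARD('n)"
    and f: "locally_integrable f" "\<And>y. 0 \<le> f y"
    and fin: "wolff_potential \<beta> \<gamma> f 0 \<noteq> \<infinity>" and pos: "0 < wolff_potential \<beta> \<gamma> f 0"
    and "0 < K" and e: "0 < e" and \<sigma>: "0 < \<sigma>"
    and self: "\<And>r z. 0 < r \<Longrightarrow> norm z \<le> 3 / 2 * r \<Longrightarrow>
       K * r powr (real CARD('n) + e) * (ball_mass f 0 r / r powr (real CARD('n) - \<beta> * \<gamma>)) powr \<sigma>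
         \<le> ball_mass f z (r / 2)"
  shows "1 < \<sigma> \<and> real CARD('n) + e < (real CARD('n) - \<beta> * \<gamma>) * \<sigma>"
proof -
  define N where "N = real CARD('n)"
  define b where "b = \<beta> * \<gamma>"
  define d where "d = N - b"
  define M where "M r = ball_mass f 0 r" for r
  have b: "0 < b" and d: "0 < d" "N - d = b" using assms by (auto simp: b_def d_def N_def)
  have M_mono: "M r \<le> M t" if "r \<le> t" for r t
    unfolding M_def by (rule ball_mass_mono[OF f]) (use that in auto)
  have M_nonneg: "0 \<le> M r" for r
    unfolding M_def by (rule ball_mass_nonneg[OF f(2)])
  obtain r0 where r0: "0 < r0" "0 < M r0"
  proof -
    have "\<exists>r>0. M r \<noteq> 0"
    proof (rule ccontr)
      assume "\<not> ?thesis"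
      then have "wolff_potential \<beta> \<gamma> f 0 = (\<integral>\<^sup>+ t. 0 \<partial>(lborel :: real measure))"
        unfolding wolff_potential_def
        by (intro nn_integral_cong) (auto simp: M_def indicator_def)
      with pos show False by simp
    qed
    with M_nonneg that show ?thesis by (metis less_eq_real_def)
  qed
  have self': "K * r powr (N + e) * (M r / r powr d) powr \<sigma> \<le> ball_mass f z (r / 2)"
    if "0 < r" "norm z \<le> 3 / 2 * r" for r z
    using self[OF that] by (simp add: N_def M_def d_def b_def)
  have self0: "K * r powr (N + e) * (M r / r powr d) powr \<sigma> \<le> M r" if "0 < r" for r
  proof -
    have "ball_mass f 0 (r / 2) \<le> M r"
      using M_mono[of "r / 2" r] that by (simp add: M_def)
    with self'[of r 0] that show ?thesis by simp
  qed

  have "1 < \<sigma>"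
  proof (rule ccontr)
    assume "\<not> 1 < \<sigma>"
    \<comment> \<open>The potential at the origin dominates a power of \<open>m\<close>, so \<open>m\<close> is bounded by \<open>B\<close>.\<close>
    obtain w where w: "wolff_potential \<beta> \<gamma> f 0 = ennreal w" "0 \<le> w"
      using fin by (cases "wolff_potential \<beta> \<gamma> f 0") auto
    define B where "B = (2 * w) powr (\<gamma> - 1) * 6 powr d"
    have bound: "M r / r powr d \<le> B" if "0 < r" for r
    proof -
      have "ennreal ((M r / (6 * r) powr d) powr (1 / (\<gamma> - 1)) / 2) \<le> ennreal w"
        using wolff_potential_ge_centred_mass[of \<gamma> \<beta> f r 0] assms that
        by (simp add: w(1) M_def d_def N_def b_def)
      then have "(M r / (6 * r) powr d) powr (1 / (\<gamma> - 1)) \<le> 2 * w"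
        using w by (simp add: ennreal_le_iff)
      then have "((M r / (6 * r) powr d) powr (1 / (\<gamma> - 1))) powr (\<gamma> - 1) \<le> (2 * w) powr (\<gamma> - 1)"
        using assms by (intro powr_mono2) auto
      then have "M r / (6 * r) powr d \<le> (2 * w) powr (\<gamma> - 1)"
        using assms that M_nonneg[of r] by (simp add: powr_powr)
      then show ?thesis using that by (simp add: B_def powr_mult field_simps)
    qed
    obtain r where r: "r0 \<le> r" "0 < r" "B powr (1 - \<sigma>) < K * r powr (b + e)"
      using powr_unbounded[of "b + e" K r0 "B powr (1 - \<sigma>)"] b \<open>0 < K\<close> e by auto
    define m where "m = M r / r powr d"
    have m: "0 < m" "m \<le> B"
      using M_mono[OF r(1)] r0 r(2) bound[OF r(2)] by (auto simp: m_def)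
    have "r powr (N + e) = r powr (b + e) * r powr d"
      by (simp add: powr_add[symmetric] d_def add.commute)
    then have "K * r powr (b + e) * m powr \<sigma> \<le> m"
      using self0[OF r(2)] r by (simp add: m_def field_simps)
    then have "K * r powr (b + e) \<le> m powr (1 - \<sigma>)"
      using m by (simp add: powr_diff field_simps)
    also have "\<dots> \<le> B powr (1 - \<sigma>)"
      using m \<open>\<not> 1 < \<sigma>\<close> by (intro powr_mono2) auto
    finally show False using r by simp
  qed
  moreover have "N + e < d * \<sigma>"
  proof (rule ccontr)
    assume neg: "\<not> N + e < d * \<sigma>"
    have ge: "K * M r powr \<sigma> \<le> ball_mass f z (r / 2)" if "1 \<le> r" "norm z \<le> 3 / 2 * r" for r z
    proof -
      have "K * M r powr \<sigma> \<le> K * M r powr \<sigma> * r powr (N + e - d * \<sigma>)"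
        using mult_left_mono[OF ge_one_powr_ge_zero[OF that(1), of "N + e - d * \<sigma>"],
            of "K * M r powr \<sigma>"] neg \<open>0 < K\<close>
        by simp
      also have "\<dots> = K * r powr (N + e) * (M r / r powr d) powr \<sigma>"
        by (simp add: powr_divide powr_powr powr_diff)
      also have "\<dots> \<le> ball_mass f z (r / 2)"
        using self' that by simp
      finally show ?thesis .
    qed
    define r1 where "r1 = max r0 1"
    have r1: "1 \<le> r1" "0 < M r1"
      using M_mono[of r0 r1] r0 by (auto simp: r1_def)
    define \<delta> where "\<delta> = K * M r1 powr \<sigma>"
    have \<delta>: "0 < \<delta>" using r1 \<open>0 < K\<close> by (simp add: \<delta>_def)
    have bound: "M r \<le> (1 / K) powr (1 / (\<sigma> - 1))" if "r1 \<le> r" for r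
    proof -
      have Mr: "0 < M r" using M_mono[OF that] r1 by simp
      have "ball_mass f 0 (r / 2) \<le> M r"
        using M_mono[of "r / 2" r] that r1 by (simp add: M_def)
      then have "K * M r powr \<sigma> \<le> M r"
        using ge[of r 0] that r1 by simp
      then have "M r powr (\<sigma> - 1) \<le> 1 / K"
        using Mr \<open>0 < K\<close> by (simp add: powr_diff field_simps)
      then have "(M r powr (\<sigma> - 1)) powr (1 / (\<sigma> - 1)) \<le> (1 / K) powr (1 / (\<sigma> - 1))"
        using \<open>1 < \<sigma>\<close> by (intro powr_mono2) auto
      then show ?thesis using Mr \<open>1 < \<sigma>\<close> by (simp add: powr_powr)
    qed
    have step: "M r + \<delta> \<le> M (2 * r)" if "r1 \<le> r" for r
    proof -
      have r: "1 \<le> r" using that r1 by simp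
      \<comment> \<open>The ball of radius \<open>r/2\<close> around \<open>z\<close> lies in the shell between the radii \<open>r\<close> and \<open>2r\<close>.\<close>
      obtain z :: "real ^ 'n" where z: "norm z = 3 / 2 * r"
        using vector_choose_size[of "3 / 2 * r"] r by auto
      have "norm y < 2 * r \<and> r \<le> norm y" if "norm (z - y) < r / 2" for y
        using that z norm_triangle_ineq2[of y z] norm_triangle_ineq2[of z y]
        by (simp add: norm_minus_commute)
      then have "M r + ball_mass f z (r / 2) \<le> M (2 * r)"
        unfolding M_def using r
        by (intro ball_mass_add_le[OF f]) (force simp: dist_norm)+
      moreover have "\<delta> \<le> K * M r powr \<sigma>"
        unfolding \<delta>_def using \<open>0 < K\<close> M_mono[OF \<open>r1 \<le> r\<close>] r1 \<sigma>
        by (intro mult_left_mono powr_mono2) auto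
      ultimately show ?thesis using ge[of r z] z r by simp
    qed
    have grow: "real k * \<delta> \<le> M (2 ^ k * r1)" for k
    proof (induction k)
      case 0 show ?case by (simp add: M_nonneg)
    next
      case (Suc k)
      have "r1 \<le> 2 ^ k * r1" using r1 by simp
      from step[OF this] Suc show ?case by (simp add: algebra_simps)
    qed
    obtain k where "(1 / K) powr (1 / (\<sigma> - 1)) < real k * \<delta>"
      using ex_less_of_nat_mult[OF \<delta>] by blast
    moreover have "r1 \<le> 2 ^ k * r1" using r1 by simp
    ultimately show False using grow[of k] bound[of "2 ^ k * r1"] by linarith
  qed
  ultimately show ?thesis by (simp add: N_def d_def b_def)
qed

lemma double_bounded_pos:
  assumes "double_bounded c"
  shows "0 < c x"
proof -
  from assms obtain C where "0 < C" "1 / C \<le> c x"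
    by (auto simp: double_bounded_def)
  moreover have "0 < 1 / C" using \<open>0 < C\<close> by simp
  ultimately show ?thesis by linarith
qed

text \<open>Only one of the two quotients is bounded here; the other follows by exchanging the roles of \<open>u\<close> and
  \<open>v\<close>. Applying the one-equation estimate first to \<open>u\<close> and then to \<open>v\<close> produces the self-improving
  inequality with \<open>\<sigma> = pq/(\<gamma>-1)\<^sup>2\<close> and \<open>e = \<beta>\<gamma>q/(\<gamma>-1)\<close>. The two resulting
  inequalities on \<open>\<sigma>\<close> are the two claims after multiplication by \<open>(\<gamma>-1)\<^sup>2\<close>.\<close>

lemma system_exponent_conditions:
  fixes u v c1 c2 :: "real ^ 'n \<Rightarrow> real" and \<beta> \<gamma> p q :: real
  assumes "0 < \<beta>" "1 < \<gamma>" "\<beta> * \<gamma> < real CARD('n)" "0 < p" "0 < q"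
    and c: "double_bounded c1" "double_bounded c2"
    and sol: "positive_solution_system \<beta> \<gamma> p q c1 c2 u v"
  shows "(\<gamma> - 1)\<^sup>2 < p * q \<and>
    \<beta> * \<gamma> * (q + \<gamma> - 1) / (p * q - (\<gamma> - 1)\<^sup>2) < (real CARD('n) - \<beta> * \<gamma>) / (\<gamma> - 1)"
proof -
  define N where "N = real CARD('n)"
  define d where "d = real CARD('n) - \<beta> * \<gamma>"
  define s where "s = 1 / (\<gamma> - 1)"
  define F where "F = (\<lambda>y. v y powr q)"
  define G where "G = (\<lambda>y. u y powr p)"
  have s: "0 < s" using assms by (simp add: s_def)
  have pos: "0 < u x" "0 < v x" for x
    using sol by (auto simp: positive_solution_system_def)
  have F: "locally_integrable F" "\<And>y. 0 \<le> F y" and G: "locally_integrable G" "\<And>y. 0 \<le> G y"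
    and equ: "\<And>x. ennreal (u x) = ennreal (c1 x) * wolff_potential \<beta> \<gamma> F x"
    and eqv: "\<And>x. ennreal (v x) = ennreal (c2 x) * wolff_potential \<beta> \<gamma> G x"
    using sol by (auto simp: positive_solution_system_def F_def G_def)
  obtain C1 C2 where C: "0 < C1" "\<And>x. 1 / C1 \<le> c1 x" "0 < C2" "\<And>x. 1 / C2 \<le> c2 x"
    using c by (auto simp: double_bounded_def)
  have "ennreal (1 / C1) * wolff_potential \<beta> \<gamma> F x \<le> ennreal (u x)" for x
    unfolding equ by (intro mult_right_mono ennreal_leI C) simp
  then obtain k1 where k1: "0 < k1" "\<And>r z. 0 < r \<Longrightarrow> norm z \<le> 3 / 2 * r \<Longrightarrow>
      k1 * r powr N * (ball_mass F 0 r / r powr d) powr (s * p) \<le> ball_mass G z (r / 2)"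
    using ball_mass_powr_ge[OF assms(2,3) F G(1)[unfolded G_def] pos(1) \<open>0 < p\<close> C(1)]
    unfolding G_def N_def d_def s_def by blast
  have "ennreal (1 / C2) * wolff_potential \<beta> \<gamma> G x \<le> ennreal (v x)" for x
    unfolding eqv by (intro mult_right_mono ennreal_leI C) simp
  then obtain k2 where k2: "0 < k2" "\<And>r z. 0 < r \<Longrightarrow> norm z \<le> 3 / 2 * r \<Longrightarrow>
      k2 * r powr N * (ball_mass G 0 r / r powr d) powr (s * q) \<le> ball_mass F z (r / 2)"
    using ball_mass_powr_ge[OF assms(2,3) G F(1)[unfolded F_def] pos(2) \<open>0 < q\<close> C(3)]
    unfolding F_def N_def d_def s_def by blast
  define e where "e = (N - d) * (s * q)"
  define \<sigma> where "\<sigma> = s * p * (s * q)"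
  define K where "K = k2 * k1 powr (s * q)"
  have "1 < \<sigma> \<and> N + e < d * \<sigma>"
    unfolding N_def d_def
  proof (rule no_global_solution_inequality[OF assms(1-3) F])
    show "wolff_potential \<beta> \<gamma> F 0 \<noteq> \<infinity>"
    proof
      assume "wolff_potential \<beta> \<gamma> F 0 = \<infinity>"
      then have "ennreal (u 0) = \<infinity>"
        using equ[of 0] double_bounded_pos[OF c(1), of 0] by (simp add: ennreal_mult_top)
      then show False by simp
    qed
    show "0 < wolff_potential \<beta> \<gamma> F 0"
      using equ[of 0] pos(1)[of 0] by (metis ennreal_eq_0_iff mult_zero_right not_gr_zero not_le)
    show "0 < K" using k1(1) k2(1) by (simp add: K_def)
    show "0 < e" using assms s by (simp add: e_def N_def d_def)
    show "0 < \<sigma>" using assms s by (simp add: \<sigma>_def)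
  next
    fix r :: real and z :: "real ^ 'n"
    assume r: "0 < r" "norm z \<le> 3 / 2 * r"
    have "ball_mass G 0 (r / 2) \<le> ball_mass G 0 r"
      by (rule ball_mass_mono[OF G]) (use r in auto)
    then have "k1 * r powr N * (ball_mass F 0 r / r powr d) powr (s * p) \<le> ball_mass G 0 r"
      using k1(2)[of r 0] r by simp
    then have "(k1 * r powr N * (ball_mass F 0 r / r powr d) powr (s * p) / r powr d) powr (s * q)
        \<le> (ball_mass G 0 r / r powr d) powr (s * q)"
      using k1(1) s \<open>0 < q\<close> r by (intro powr_mono2 divide_right_mono) auto
    also have "k1 * r powr N * (ball_mass F 0 r / r powr d) powr (s * p) / r powr d
        = k1 * r powr (N - d) * (ball_mass F 0 r / r powr d) powr (s * p)"
      by (simp add: powr_diff)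
    finally have "k1 powr (s * q) * r powr e * (ball_mass F 0 r / r powr d) powr \<sigma>
        \<le> (ball_mass G 0 r / r powr d) powr (s * q)"
      by (simp only: powr_mult powr_powr e_def \<sigma>_def)
    then have "k2 * r powr N * (k1 powr (s * q) * r powr e * (ball_mass F 0 r / r powr d) powr \<sigma>)
        \<le> k2 * r powr N * (ball_mass G 0 r / r powr d) powr (s * q)"
      using k2(1) by (intro mult_left_mono) auto
    also have "\<dots> \<le> ball_mass F z (r / 2)"
      by (rule k2(2)[OF r])
    finally show "K * r powr (real CARD('n) + e) *
        (ball_mass F 0 r / r powr (real CARD('n) - \<beta> * \<gamma>)) powr \<sigma> \<le> ball_mass F z (r / 2)"
      by (simp add: K_def powr_add N_def d_def mult_ac)
  qed
  then have *: "1 < \<sigma>" "N + e < d * \<sigma>" by auto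
  define g where "g = \<gamma> - 1"
  have g: "0 < g" "s = 1 / g" using assms by (auto simp: g_def s_def)
  have \<sigma>: "\<sigma> = p * q / g\<^sup>2"
    by (simp add: \<sigma>_def g power2_eq_square)
  have pq: "g\<^sup>2 < p * q" using *(1) g by (simp add: \<sigma> field_simps)
  have "(N + (N - d) * q / g) * g\<^sup>2 < d * (p * q / g\<^sup>2) * g\<^sup>2"
    using *(2) g unfolding e_def \<sigma> by (intro mult_strict_right_mono) auto
  moreover have "(N + (N - d) * q / g) * g\<^sup>2 = N * g\<^sup>2 + (N - d) * q * g"
    using g(1) by (simp add: field_simps power2_eq_square)
  moreover have "d * (p * q / g\<^sup>2) * g\<^sup>2 = d * (p * q)"
    using g(1) by simp
  ultimately have "N * g\<^sup>2 + (N - d) * q * g < d * (p * q)"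
    by simp
  then have "(N - d) * (q + g) * g < d * (p * q - g\<^sup>2)"
    by (simp add: algebra_simps power2_eq_square)
  then have "(N - d) * (q + g) / (p * q - g\<^sup>2) < d / g"
    using pq g by (simp add: divide_simps mult_ac)
  with pq show ?thesis by (simp add: g_def N_def d_def add_diff_eq)
qed

section \<open>Wolff potentials of power-like decaying functions\<close>

abbreviation decay :: "real \<Rightarrow> real ^ 'n \<Rightarrow> real" where
  "decay \<theta> y \<equiv> (1 + norm y) powr - \<theta>"

lemma locally_integrable_decay: "locally_integrable (decay \<theta>)"
  by (rule locally_integrable_continuous)
    (intro continuous_on_powr continuous_on_add continuous_on_norm continuous_on_id
      continuous_on_const ballI, simp add: add_nonneg_eq_0_iff)

text \<open>Halving the ball: the part outside radius \<open>r/2\<close> has mass at most a constant times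
  \<open>r powr (n - \<theta>)\<close>, and the bound for \<open>r/2\<close> is smaller than the one for \<open>r\<close> by the factor
  \<open>2 powr (\<theta> - n) < 1\<close>. The constant \<open>K\<close> is the fixed point of the resulting recursion, so the
  estimate propagates from radii at most \<open>1\<close> to radii at most \<open>2\<^sup>k\<close> for every \<open>k\<close>.\<close>

lemma ball_mass_decay_centred_le:
  assumes "0 < \<theta>" "\<theta> < real CARD('n)"
  shows "\<exists>K>0. \<forall>r>0. ball_mass (decay \<theta>) (0 :: real ^ 'n) r \<le> K * r powr (real CARD('n) - \<theta>)"
proof -
  define N where "N = real CARD('n)"
  define \<omega> where "\<omega> = unit_ball_vol N"
  define \<eta> where "\<eta> = (1 / 2 :: real) powr (N - \<theta>)"
  define K where "K = 2 powr \<theta> * \<omega> / (1 - \<eta>)"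
  have N: "0 < N" "0 < N - \<theta>" using assms by (auto simp: N_def)
  have \<omega>: "0 < \<omega>" using N by (simp add: \<omega>_def)
  have \<eta>: "0 < \<eta>" "\<eta> < 1"
    using N powr_less_mono2[of "N - \<theta>" "1 / 2" 1] by (auto simp: \<eta>_def)
  have K: "0 < K" using \<omega> \<eta> by (simp add: K_def)
  have K_eq: "K * \<eta> + 2 powr \<theta> * \<omega> = K"
    using \<eta> by (simp add: K_def field_simps)
  have "\<omega> \<le> 2 powr \<theta> * \<omega>"
    using \<omega> ge_one_powr_ge_zero[of 2 \<theta>] assms by simp
  then have K_ge: "\<omega> \<le> K"
    using K_eq K \<eta> by (smt (verit) mult_pos_pos)
  let ?w = "decay \<theta> :: real ^ 'n \<Rightarrow> real"
  have "\<forall>r. 0 < r \<longrightarrow> r \<le> 2 ^ k \<longrightarrow> ball_mass ?w 0 r \<le> K * r powr (N - \<theta>)" for k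
  proof (induction k)
    case 0
    show ?case
    proof (intro allI impI)
      fix r :: real assume r: "0 < r" "r \<le> 2 ^ 0"
      have "ball_mass ?w 0 r \<le> 1 * (\<omega> * r powr N)"
        unfolding \<omega>_def N_def
      proof (rule ball_mass_le[OF locally_integrable_decay])
        fix y :: "real ^ 'n"
        show "decay \<theta> y \<le> 1"
          using powr_mono2'[of "- \<theta>" 1 "1 + norm y"] assms by simp
      qed (use r in auto)
      also have "\<dots> \<le> K * r powr (N - \<theta>)"
        using r K_ge \<omega> assms powr_mono'[of "N - \<theta>" N r] by (simp add: mult_mono)
      finally show "ball_mass ?w 0 r \<le> K * r powr (N - \<theta>)" .
    qed
  next
    case (Suc k)
    show ?case
    proof (intro allI impI)
      fix r :: real assume r: "0 < r" "r \<le> 2 ^ Suc k"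
      define L where "L = (r / 2) powr - \<theta>"
      note int = integrable_indicator_ball[OF locally_integrable_decay[of \<theta>]]
        and int' = integrable_indicator_ball[OF locally_integrable_continuous[OF continuous_on_const]]
      have "ball_mass ?w 0 r \<le> (\<integral>y. indicator (ball 0 (r / 2)) y * ?w y
          + indicator (ball 0 r) y * L \<partial>lebesgue)"
        unfolding set_lebesgue_integral_def real_scaleR_def
      proof (rule integral_mono[OF int Bochner_Integration.integrable_add[OF int int']])
        fix y :: "real ^ 'n"
        show "indicator (ball 0 r) y * ?w y
            \<le> indicator (ball 0 (r / 2)) y * ?w y + indicator (ball 0 r) y * L"
          using powr_mono2'[of "- \<theta>" "r / 2" "1 + norm y"] r assms
          by (auto simp: indicator_def L_def)
      qed
      also have "\<dots> = ball_mass ?w 0 (r / 2) + (LINT y:ball (0::real^'n) r|lebesgue. L)"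
        by (simp add: set_lebesgue_integral_def Bochner_Integration.integral_add[OF int int'])
      also have "(LINT y:ball (0::real^'n) r|lebesgue. L) = L * (\<omega> * r powr N)"
        using integral_const_ball[of r "0 :: real ^ 'n" L] r by (simp add: \<omega>_def N_def)
      also have "L * (\<omega> * r powr N) = 2 powr \<theta> * \<omega> * r powr (N - \<theta>)"
        by (simp add: L_def powr_divide powr_minus powr_diff field_simps)
      also have "ball_mass ?w 0 (r / 2) \<le> K * (r / 2) powr (N - \<theta>)"
        using Suc r by simp
      also have "K * (r / 2) powr (N - \<theta>) = K * \<eta> * r powr (N - \<theta>)"
        by (simp add: \<eta>_def powr_divide)
      also have "K * \<eta> * r powr (N - \<theta>) + 2 powr \<theta> * \<omega> * r powr (N - \<theta>) = K * r powr (N - \<theta>)"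
        by (subst (2) K_eq[symmetric]) (simp add: algebra_simps)
      finally show "ball_mass ?w 0 r \<le> K * r powr (N - \<theta>)" by simp
    qed
  qed
  moreover have "\<exists>k. r \<le> 2 ^ k" for r :: real
    using real_arch_pow[of 2 r] by (auto intro: less_imp_le)
  ultimately show ?thesis
    using K unfolding N_def by metis
qed

text \<open>The radii split at half of \<open>R = 1 + norm x\<close>. Below \<open>R/2\<close> the density is comparable to its value
  \<open>R powr -\<theta>\<close> at \<open>x\<close>, above \<open>R/2\<close> the ball lies in a centred ball of radius \<open>3t\<close>. The integral over the
  first range converges at \<open>0\<close> because \<open>\<beta>\<gamma> > 0\<close> and the one over the second converges at infinity
  because \<open>\<theta> > \<beta>\<gamma>\<close>; both are multiples of the same power of \<open>R\<close>.\<close>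

lemma wolff_potential_decay_le:
  fixes \<beta> \<gamma> \<theta> :: real
  assumes "0 < \<beta>" "1 < \<gamma>" "\<beta> * \<gamma> < \<theta>" "\<theta> < real CARD('n)"
  shows "\<exists>k>0. \<forall>x :: real ^ 'n.
    wolff_potential \<beta> \<gamma> (decay \<theta>) x \<le> ennreal (k * decay ((\<theta> - \<beta> * \<gamma>) / (\<gamma> - 1)) x)"
proof -
  define N where "N = real CARD('n)"
  define \<omega> where "\<omega> = unit_ball_vol N"
  define b where "b = \<beta> * \<gamma>"
  define s where "s = 1 / (\<gamma> - 1)"
  have b: "0 < b" "b < \<theta>" "\<theta> < N" and s: "0 < s" 
    using assms by (auto simp: b_def s_def N_def)
  have N: "0 < N" using b by simp
  have \<omega>: "0 < \<omega>" using N by (simp add: \<omega>_def)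
  let ?w = "decay \<theta> :: real ^ 'n \<Rightarrow> real"
  obtain K where K: "0 < K" "\<And>r. 0 < r \<Longrightarrow> ball_mass ?w 0 r \<le> K * r powr (N - \<theta>)"
    using ball_mass_decay_centred_le[where 'n='n, of \<theta>] b unfolding N_def by auto
  define A where "A = max (2 powr \<theta> * \<omega>) (K * 3 powr (N - \<theta>))"
  have A: "0 < A" using \<omega> by (simp add: A_def less_max_iff_disj)
  have near: "ball_mass ?w x t \<le> A * (1 + norm x) powr - \<theta> * t powr N"
    if t: "0 < t" "t \<le> (1 + norm x) / 2" for x t
  proof -
    have "ball_mass ?w x t \<le> ((1 + norm x) / 2) powr - \<theta> * (\<omega> * t powr N)"
      unfolding \<omega>_def N_def
    proof (rule ball_mass_le[OF locally_integrable_decay])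
      fix y assume "y \<in> ball x t"
      then have "(1 + norm x) / 2 \<le> 1 + norm y"
        using norm_triangle_ineq2[of x y] t by (simp add: dist_norm)
      then show "?w y \<le> ((1 + norm x) / 2) powr - \<theta>"
        using b by (intro powr_mono2') (auto simp: add_pos_nonneg)
    qed (use t in auto)
    also have "\<dots> = 2 powr \<theta> * \<omega> * ((1 + norm x) powr - \<theta> * t powr N)"
      by (simp add: powr_divide powr_minus field_simps)
    also have "\<dots> \<le> A * ((1 + norm x) powr - \<theta> * t powr N)"
      by (intro mult_right_mono) (auto simp: A_def)
    finally show ?thesis by (simp add: mult_ac)
  qed
  have far: "ball_mass ?w x t \<le> A * t powr (N - \<theta>)"
    if t: "(1 + norm x) / 2 \<le> t" for x t
  proof -
    have "0 < (1 + norm x) / 2" by (simp add: add_pos_nonneg)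
    then have t0: "0 < t" using t by (rule less_le_trans)
    have "ball_mass ?w x t \<le> ball_mass ?w 0 (3 * t)"
    proof (rule ball_mass_mono[OF locally_integrable_decay])
      show "ball x t \<subseteq> ball 0 (3 * t)"
      proof
        fix y assume "y \<in> ball x t"
        then show "y \<in> ball 0 (3 * t)"
          using norm_triangle_ineq2[of y x] t by (simp add: dist_norm norm_minus_commute)
      qed
    qed simp
    also have "\<dots> \<le> K * (3 * t) powr (N - \<theta>)" using K(2)[of "3 * t"] t0 by simp
    also have "\<dots> = K * 3 powr (N - \<theta>) * t powr (N - \<theta>)" by (simp add: powr_mult)
    also have "\<dots> \<le> A * t powr (N - \<theta>)"
      by (intro mult_right_mono) (auto simp: A_def)
    finally show ?thesis .
  qed
  define k where "k = A powr s * ((1 / 2) powr (b * s) / (b * s) + (1 / 2) powr (- ((\<theta> - b) * s)) / ((\<theta> - b) * s))"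
  have "wolff_potential \<beta> \<gamma> ?w x \<le> ennreal (k * decay ((\<theta> - b) * s) x)" for x
  proof -
    define R where "R = 1 + norm x"
    have R: "0 < R" by (simp add: R_def add_pos_nonneg)
    have d: "real CARD('n) - \<beta> * \<gamma> = N - b" by (simp add: N_def b_def)
    define h1 where "h1 t = (A * R powr - \<theta>) powr s * t powr (b * s - 1)" for t
    define h2 where "h2 t = A powr s * t powr (- ((\<theta> - b) * s) - 1)" for t
    have "wolff_potential \<beta> \<gamma> ?w x \<le>
        (\<integral>\<^sup>+ t. ennreal (h1 t) * indicator {0..R / 2} t + ennreal (h2 t) * indicator {R / 2..} t \<partial>lborel)"
      unfolding wolff_potential_def d s_def[symmetric]
    proof (rule nn_integral_mono)
      fix t :: real
      show "ennreal ((ball_mass ?w x t / t powr (N - b)) powr s / t) * indicator {0<..} t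
          \<le> ennreal (h1 t) * indicator {0..R / 2} t + ennreal (h2 t) * indicator {R / 2..} t"
      proof (cases "0 < t")
        case t: True
        have shape: "(ball_mass ?w x t / t powr (N - b)) powr s / t \<le> B powr s * t powr (a * s - 1)"
          if "ball_mass ?w x t \<le> B * t powr (N - b + a)" for B a
        proof -
          have "ball_mass ?w x t / t powr (N - b) \<le> B * t powr a"
            using that t unfolding powr_add[of t "N - b" a] by (simp add: field_simps)
          then have "(ball_mass ?w x t / t powr (N - b)) powr s \<le> (B * t powr a) powr s"
            using s ball_mass_nonneg[of ?w x t] by (intro powr_mono2) auto
          also have "\<dots> = B powr s * t powr (a * s)"
            by (simp add: powr_mult powr_powr)
          finally show ?thesis
            using t by (simp add: powr_diff divide_right_mono)
        qed
        show ?thesis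
        proof (cases "t \<le> R / 2")
          case True
          have "(ball_mass ?w x t / t powr (N - b)) powr s / t \<le> h1 t"
            unfolding h1_def by (rule shape) (use near[of t x] t True in \<open>simp add: R_def\<close>)
          then show ?thesis
            using t True by (auto intro!: add_increasing2 ennreal_leI)
        next
          case False
          have "(ball_mass ?w x t / t powr (N - b)) powr s / t \<le> A powr s * t powr ((b - \<theta>) * s - 1)"
            by (rule shape) (use far[of x t] False in \<open>simp add: R_def\<close>)
          also have "\<dots> = h2 t" by (simp add: h2_def algebra_simps)
          finally show ?thesis
            using t False by (auto intro!: ennreal_leI)
        qed
      qed simp
    qed
    also have "\<dots> = (\<integral>\<^sup>+ t. ennreal (h1 t) * indicator {0..R / 2} t \<partial>lborel)
        + (\<integral>\<^sup>+ t. ennreal (h2 t) * indicator {R / 2..} t \<partial>lborel)"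
      unfolding h1_def h2_def by (rule nn_integral_add) measurable
    also have "(\<integral>\<^sup>+ t. ennreal (h1 t) * indicator {0..R / 2} t \<partial>lborel)
        = ennreal ((A * R powr - \<theta>) powr s * ((R / 2) powr (b * s) / (b * s)))"
    proof (rule nn_integral_has_integral_lebesgue')
      show "(h1 has_integral (A * R powr - \<theta>) powr s * ((R / 2) powr (b * s) / (b * s))) {0..R / 2}"
        unfolding h1_def using has_integral_powr_from_0[of "b * s - 1" "R / 2"] b s R
        by (intro has_integral_mult_right) simp
    qed (simp add: h1_def)
    also have "(\<integral>\<^sup>+ t. ennreal (h2 t) * indicator {R / 2..} t \<partial>lborel)
        = ennreal (A powr s * ((R / 2) powr (- ((\<theta> - b) * s)) / ((\<theta> - b) * s)))"
    proof (rule nn_integral_has_integral_lebesgue')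
      show "(h2 has_integral A powr s * ((R / 2) powr (- ((\<theta> - b) * s)) / ((\<theta> - b) * s))) {R / 2..}"
        unfolding h2_def using has_integral_powr_to_inf[of "- ((\<theta> - b) * s) - 1" "R / 2"] b s R
        by (intro has_integral_mult_right) simp
    qed (simp add: h2_def)
    also have "ennreal ((A * R powr - \<theta>) powr s * ((R / 2) powr (b * s) / (b * s)))
        + ennreal (A powr s * ((R / 2) powr (- ((\<theta> - b) * s)) / ((\<theta> - b) * s)))
        = ennreal (k * R powr - ((\<theta> - b) * s))"
    proof -
      have "R powr (- (\<theta> * s)) * R powr (b * s) = R powr - ((\<theta> - b) * s)"
        by (simp add: powr_add[symmetric] algebra_simps)
      then have "(A * R powr - \<theta>) powr s * ((R / 2) powr (b * s) / (b * s))
          = A powr s * ((1 / 2) powr (b * s) / (b * s)) * R powr - ((\<theta> - b) * s)"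
        by (simp add: powr_mult powr_powr powr_divide field_simps)
      moreover have "A powr s * ((R / 2) powr (- ((\<theta> - b) * s)) / ((\<theta> - b) * s))
          = A powr s * ((1 / 2) powr (- ((\<theta> - b) * s)) / ((\<theta> - b) * s)) * R powr - ((\<theta> - b) * s)"
        by (simp add: powr_divide)
      ultimately show ?thesis
        using b s by (simp add: ennreal_plus[symmetric] k_def algebra_simps del: ennreal_plus)
    qed
    finally show ?thesis by (simp add: R_def)
  qed
  moreover have "0 < k"
    using A b s by (auto simp: k_def intro!: mult_pos_pos add_pos_pos divide_pos_pos)
  ultimately show ?thesis
    by (auto simp: b_def s_def)
qed

text \<open>The radii between \<open>R = 1 + norm x\<close> and \<open>2R\<close> suffice: the density is at least \<open>(3R) powr -\<theta>\<close> on all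
  these balls.\<close>

lemma wolff_potential_decay_ge:
  fixes \<beta> \<gamma> \<theta> :: real
  assumes "1 < \<gamma>" "0 < \<theta>" "\<beta> * \<gamma> < real CARD('n)"
  shows "\<exists>k>0. \<forall>x :: real ^ 'n.
    ennreal (k * decay ((\<theta> - \<beta> * \<gamma>) / (\<gamma> - 1)) x) \<le> wolff_potential \<beta> \<gamma> (decay \<theta>) x"
proof -
  define N where "N = real CARD('n)"
  define \<omega> where "\<omega> = unit_ball_vol N"
  define d where "d = N - \<beta> * \<gamma>"
  define s where "s = 1 / (\<gamma> - 1)"
  define k where "k = (3 powr - \<theta> * \<omega> / 2 powr d) powr s / 2"
  have \<omega>: "0 < \<omega>" by (simp add: \<omega>_def N_def)
  let ?w = "decay \<theta> :: real ^ 'n \<Rightarrow> real"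
  have "ennreal (k * decay ((\<theta> - \<beta> * \<gamma>) * s) x) \<le> wolff_potential \<beta> \<gamma> ?w x" for x
  proof -
    define R where "R = 1 + norm x"
    have R: "0 < R" by (simp add: R_def add_pos_nonneg)
    define m where "m = (3 * R) powr - \<theta> * (\<omega> * R powr N)"
    have "m \<le> ball_mass ?w x t" if t: "R \<le> t" "t \<le> 2 * R" for t
    proof -
      have "m \<le> (3 * R) powr - \<theta> * (\<omega> * t powr N)"
        unfolding m_def using \<omega> R t
        by (intro mult_left_mono powr_mono2) (auto simp: N_def)
      also have "\<dots> \<le> ball_mass ?w x t"
        unfolding \<omega>_def N_def
      proof (rule ball_mass_ge[OF locally_integrable_decay])
        fix y assume "y \<in> ball x t"
        then have "1 + norm y \<le> 3 * R"
          using norm_triangle_ineq2[of y x] t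
          by (simp add: dist_norm norm_minus_commute R_def)
        then show "(3 * R) powr - \<theta> \<le> ?w y"
          using assms by (intro powr_mono2') (auto simp: add_pos_nonneg)
      qed (use t R in auto)
      finally show ?thesis .
    qed
    then have "ennreal ((m / (2 * R) powr (real CARD('n) - \<beta> * \<gamma>)) powr (1 / (\<gamma> - 1)) / 2)
        \<le> wolff_potential \<beta> \<gamma> ?w x"
      using \<omega> by (intro wolff_potential_ge assms R) (auto simp: m_def)
    also have "(m / (2 * R) powr (real CARD('n) - \<beta> * \<gamma>)) powr (1 / (\<gamma> - 1)) / 2
        = k * R powr - ((\<theta> - \<beta> * \<gamma>) * s)"
    proof -
      have "R powr - \<theta> * R powr N / R powr d = R powr - (\<theta> - \<beta> * \<gamma>)"
        by (simp add: powr_add[symmetric] powr_diff[symmetric] d_def)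
      moreover have "m / (2 * R) powr d
          = 3 powr - \<theta> * \<omega> / 2 powr d * (R powr - \<theta> * R powr N / R powr d)"
        by (simp add: m_def powr_mult)
      ultimately have "m / (2 * R) powr d
          = 3 powr - \<theta> * \<omega> / 2 powr d * R powr - (\<theta> - \<beta> * \<gamma>)"
        by simp
      then have "(m / (2 * R) powr d) powr s
          = (3 powr - \<theta> * \<omega> / 2 powr d) powr s * R powr - ((\<theta> - \<beta> * \<gamma>) * s)"
        by (simp only: powr_mult powr_powr mult_minus_left)
      then show ?thesis by (simp add: k_def d_def N_def s_def)
    qed
    finally show ?thesis by (simp add: R_def)
  qed
  moreover have "0 < k" using \<omega> by (simp add: k_def)
  ultimately show ?thesis by (auto simp: s_def)
qed

text \<open>The two-sided estimate says that the potential differs from a decaying power only by a factor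
  bounded above and away from zero, and that factor can serve as the coefficient \<open>c\<close>.\<close>

lemma decay_solves_up_to_double_bounded:
  fixes \<beta> \<gamma> \<theta> :: real
  assumes "0 < \<beta>" "1 < \<gamma>" "\<beta> * \<gamma> < \<theta>" "\<theta> < real CARD('n)"
  shows "\<exists>c. double_bounded c \<and> (\<forall>x :: real ^ 'n.
    ennreal (decay ((\<theta> - \<beta> * \<gamma>) / (\<gamma> - 1)) x)
      = ennreal (c x) * wolff_potential \<beta> \<gamma> (decay \<theta>) x)"
proof -
  let ?u = "decay ((\<theta> - \<beta> * \<gamma>) / (\<gamma> - 1)) :: real ^ 'n \<Rightarrow> real"
  let ?W = "wolff_potential \<beta> \<gamma> (decay \<theta>) :: real ^ 'n \<Rightarrow> ennreal"
  have \<theta>: "0 < \<theta>" using assms by (smt (verit) mult_pos_pos)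
  obtain k where k: "0 < k" "\<And>x. ?W x \<le> ennreal (k * ?u x)"
    using wolff_potential_decay_le[OF assms] by blast
  obtain l where l: "0 < l" "\<And>x. ennreal (l * ?u x) \<le> ?W x"
    using wolff_potential_decay_ge[OF assms(2) \<theta>, where 'n='n and \<beta>=\<beta>] assms by force
  have u: "0 < ?u x" for x by (simp add: add_nonneg_eq_0_iff)
  define w where "w x = enn2real (?W x)" for x
  have W: "?W x = ennreal (w x)" for x
    using le_less_trans[OF k(2)[of x] ennreal_less_top] by (simp add: w_def)
  have w_nonneg: "0 \<le> w x" for x by (simp add: w_def)
  have w_le: "w x \<le> k * ?u x" for x
    using k(2)[of x] k(1) u[of x] by (simp add: W)
  have w_ge: "l * ?u x \<le> w x" for x
    using l(2)[of x] w_nonneg[of x] by (simp add: W)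
  have w: "0 < w x" for x
    using w_ge[of x] mult_pos_pos[OF l(1) u[of x]] by linarith
  have "double_bounded (\<lambda>x. ?u x / w x)"
    unfolding double_bounded_def
  proof (intro exI[of _ "max k (1 / l)"] conjI allI)
    show "0 < max k (1 / l)" using k(1) by simp
    fix x
    have "1 / max k (1 / l) \<le> 1 / k" using k(1) by (intro divide_left_mono) auto
    also have "\<dots> \<le> ?u x / w x" using w_le[of x] w[of x] k(1) by (simp add: field_simps)
    finally show "1 / max k (1 / l) \<le> ?u x / w x" .
    have "?u x / w x \<le> 1 / l" using w_ge[of x] w[of x] l(1) by (simp add: field_simps)
    then show "?u x / w x \<le> max k (1 / l)" by simp
  qed
  moreover have "ennreal (?u x) = ennreal (?u x / w x) * ?W x" for x
    using w[of x] by (simp add: W ennreal_mult[symmetric])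
  ultimately show ?thesis by blast
qed

section \<open>Exponents and the characterisation\<close>

lemma powr_decay: "decay \<theta> y powr a = decay (a * \<theta>) y"
  by (simp add: powr_powr mult.commute)

lemma positive_solution_equation_imp_system:
  assumes "positive_solution_equation \<beta> \<gamma> p c u"
  shows "positive_solution_system \<beta> \<gamma> p p c c u u"
  using assms by (simp add: positive_solution_equation_def positive_solution_system_def)

text \<open>For \<open>p = q\<close> the factor \<open>p + g\<close> cancels from the quotient, which turns the condition for the system into
  the one for the single equation.\<close>

lemma self_dual_exponent_condition_iff:
  fixes b g d N p :: real
  assumes "0 < b" "0 < g" "0 < d" "0 < p" "N = b + d"
  shows "N * g / d < p \<longleftrightarrow> g\<^sup>2 < p * p \<and> b * (p + g) / (p * p - g\<^sup>2) < d / g"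
proof -
  have fac: "p * p - g\<^sup>2 = (p - g) * (p + g)"
    by (simp add: algebra_simps power2_eq_square)
  have "\<not> g\<^sup>2 < p\<^sup>2 \<longleftrightarrow> \<not> g < p"
    unfolding not_less using assms by (intro power_mono_iff) auto
  then have 1: "g\<^sup>2 < p * p \<longleftrightarrow> g < p"
    by (simp only: power2_eq_square not_not simp_thms)
  have 2: "b * (p + g) / (p * p - g\<^sup>2) = b / (p - g)"
    using assms by (simp add: fac)
  have 3: "b / (p - g) < d / g \<longleftrightarrow> N * g / d < p" if "g < p"
    using assms that by (simp add: field_simps)
  have "g < N * g / d" using assms by (simp add: field_simps)
  with 1 2 3 show ?thesis by auto
qed

text \<open>The decay rates \<open>A\<close> of \<open>u\<close> and \<open>B\<close> of \<open>v\<close> are the solution of the linear system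
  \<open>g A = q B - b\<close>, \<open>g B = p A - b\<close> that the potential estimate imposes. Under the exponent
  conditions the densities decay at rates \<open>q B\<close> and \<open>p A\<close> strictly between \<open>b\<close> and \<open>b + d = n\<close>, where
  that estimate holds.\<close>

lemma decay_system_exponents:
  fixes b g d p q :: real
  assumes "0 < b" "0 < g" "0 < p" "0 < q"
    and "g\<^sup>2 < p * q" and "b * (q + g) / (p * q - g\<^sup>2) < d / g" and "b * (p + g) / (p * q - g\<^sup>2) < d / g"
  defines "A \<equiv> b * (q + g) / (p * q - g\<^sup>2)" and "B \<equiv> b * (p + g) / (p * q - g\<^sup>2)"
  shows "b < q * B" "q * B < b + d" "(q * B - b) / g = A"
    and "b < p * A" "p * A < b + d" "(p * A - b) / g = B"
proof -
  have D: "0 < p * q - g\<^sup>2" using assms by simp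
  have AB: "0 < A" "0 < B" using assms D by (auto simp: A_def B_def)
  have eq: "q * B = b + g * A" "p * A = b + g * B"
    using D by (auto simp: A_def B_def field_simps power2_eq_square)
  show "b < q * B" "b < p * A" using eq AB assms by auto
  show "(q * B - b) / g = A" "(p * A - b) / g = B" using eq assms by auto
  have "g * A < d" "g * B < d"
    using assms(2,6,7) unfolding A_def[symmetric] B_def[symmetric]
    by (auto simp: pos_less_divide_eq mult.commute)
  then show "q * B < b + d" "p * A < b + d" using eq by auto
qed

theorem theorem1p7:
  fixes \<beta> \<gamma> p q :: real
  assumes "\<beta> > 0" and "\<gamma> > 1" and "\<beta> * \<gamma> < real CARD('n::finite)"
    and "p > 0" and "q > 0"
  shows
    "((\<exists>c u :: real ^ 'n \<Rightarrow> real.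
         double_bounded c \<and> positive_solution_equation \<beta> \<gamma> p c u)
       \<longleftrightarrow> p > real CARD('n) * (\<gamma> - 1) / (real CARD('n) - \<beta> * \<gamma>))
     \<and>
     ((\<exists>c1 c2 u v :: real ^ 'n \<Rightarrow> real.
         double_bounded c1 \<and> double_bounded c2 \<and>
         positive_solution_system \<beta> \<gamma> p q c1 c2 u v)
       \<longleftrightarrow> p * q > (\<gamma> - 1)\<^sup>2 \<and>
           max (\<beta> * \<gamma> * (p + \<gamma> - 1) / (p * q - (\<gamma> - 1)\<^sup>2))
               (\<beta> * \<gamma> * (q + \<gamma> - 1) / (p * q - (\<gamma> - 1)\<^sup>2))
             < (real CARD('n) - \<beta> * \<gamma>) / (\<gamma> - 1))"
proof -
  define N where "N = real CARD('n)"
  define b where "b = \<beta> * \<gamma>"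
  define g where "g = \<gamma> - 1"
  define d where "d = N - b"
  have pos: "0 < b" "0 < g" "0 < d" "N = b + d"
    using assms by (auto simp: b_def g_def d_def N_def)
  have add_g: "x + \<gamma> - 1 = x + g" for x by (simp add: g_def)
  have necessary: "g\<^sup>2 < p * q \<and> b * (q + g) / (p * q - g\<^sup>2) < d / g"
    if "double_bounded c1" "double_bounded c2" "positive_solution_system \<beta> \<gamma> p q c1 c2 u v" "0 < p" "0 < q"
    for p q and c1 c2 u v :: "real ^ 'n \<Rightarrow> real"
    using system_exponent_conditions[OF assms(1-3) that(4,5,1-3)]
    by (simp add: add_g b_def[symmetric] g_def[symmetric] N_def[symmetric] d_def[symmetric])
  have decay_solution: "\<exists>c. double_bounded c \<and> (\<forall>x :: real ^ 'n.
      ennreal (decay ((\<theta> - b) / g) x) = ennreal (c x) * wolff_potential \<beta> \<gamma> (decay \<theta>) x)"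
    if "b < \<theta>" "\<theta> < b + d" for \<theta>
    using decay_solves_up_to_double_bounded[OF assms(1,2), of \<theta>, where 'n='n] that
    by (simp add: b_def g_def N_def d_def)
  have u_pos: "0 < decay \<theta> x" for \<theta> and x :: "real ^ 'n" by (simp add: add_nonneg_eq_0_iff)

  have eq_iff: "(\<exists>c u :: real ^ 'n \<Rightarrow> real. double_bounded c \<and> positive_solution_equation \<beta> \<gamma> p c u)
      \<longleftrightarrow> N * g / d < p" (is "?L \<longleftrightarrow> ?R")
  proof
    assume ?L
    then show ?R
      using necessary[OF _ _ positive_solution_equation_imp_system] assms(4)
        self_dual_exponent_condition_iff[OF pos(1-3) assms(4) pos(4)] by blast
  next
    assume ?R
    then have *: "g\<^sup>2 < p * p" "b * (p + g) / (p * p - g\<^sup>2) < d / g"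
      using self_dual_exponent_condition_iff[OF pos(1-3) assms(4) pos(4)] by auto
    define A where "A = b * (p + g) / (p * p - g\<^sup>2)"
    note exps = decay_system_exponents[OF pos(1,2) assms(4,4) * *(2), folded A_def]
    obtain c where "double_bounded c" "\<And>x :: real ^ 'n.
        ennreal (decay A x) = ennreal (c x) * wolff_potential \<beta> \<gamma> (decay (p * A)) x"
      using decay_solution[OF exps(1,2)] exps(3) by metis
    then have "double_bounded c \<and> positive_solution_equation \<beta> \<gamma> p c (decay A)"
      by (simp add: positive_solution_equation_def powr_decay locally_integrable_decay u_pos del: powr_gt_zero)
    then show ?L by blast
  qed

  have sys_iff: "(\<exists>c1 c2 u v :: real ^ 'n \<Rightarrow> real. double_bounded c1 \<and> double_bounded c2 \<and>
         positive_solution_system \<beta> \<gamma> p q c1 c2 u v)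
      \<longleftrightarrow> g\<^sup>2 < p * q \<and> max (b * (p + g) / (p * q - g\<^sup>2)) (b * (q + g) / (p * q - g\<^sup>2)) < d / g"
    (is "?L \<longleftrightarrow> ?R")
  proof
    assume ?L
    then obtain c1 c2 u v :: "real ^ 'n \<Rightarrow> real" where c: "double_bounded c1" "double_bounded c2"
      and sol: "positive_solution_system \<beta> \<gamma> p q c1 c2 u v" by blast
    then have swap: "positive_solution_system \<beta> \<gamma> q p c2 c1 v u"
      by (auto simp: positive_solution_system_def)
    show ?R
      using necessary[OF c sol assms(4,5)] necessary[OF c(2,1) swap assms(5,4)]
      by (simp add: mult.commute[of q p])
  next
    assume ?R
    then have *: "g\<^sup>2 < p * q" "b * (q + g) / (p * q - g\<^sup>2) < d / g" "b * (p + g) / (p * q - g\<^sup>2) < d / g"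
      by auto
    define A where "A = b * (q + g) / (p * q - g\<^sup>2)"
    define B where "B = b * (p + g) / (p * q - g\<^sup>2)"
    note exps = decay_system_exponents[OF pos(1,2) assms(4,5) *, folded A_def B_def]
    obtain c1 where "double_bounded c1" "\<And>x :: real ^ 'n.
        ennreal (decay A x) = ennreal (c1 x) * wolff_potential \<beta> \<gamma> (decay (q * B)) x"
      using decay_solution[OF exps(1,2)] exps(3) by metis
    moreover obtain c2 where "double_bounded c2" "\<And>x :: real ^ 'n.
        ennreal (decay B x) = ennreal (c2 x) * wolff_potential \<beta> \<gamma> (decay (p * A)) x"
      using decay_solution[OF exps(4,5)] exps(6) by metis
    ultimately have "double_bounded c1 \<and> double_bounded c2 \<and>
        positive_solution_system \<beta> \<gamma> p q c1 c2 (decay A) (decay B)"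
      by (simp add: positive_solution_system_def powr_decay locally_integrable_decay u_pos del: powr_gt_zero)
    then show ?L by blast
  qed
  from eq_iff sys_iff show ?thesis
    unfolding add_g by (simp only: N_def b_def g_def d_def)
qed

end
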